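(* Let $Y$ be a real Hilbert space and let $h: Y \to \mathbb{R}\cup\{+\infty\}$ be a closed, proper, convex function. Let $(\lambda_\star^{k+1}, s_\star^{k+1}, \lambda^{k+1}, s^{k+1})_{k\in\mathbb{N}}$ be generated by the inexact proximal point algorithm (IPPA) on $h$ with errors $(\varepsilon_k)_{k\ge 1}$ and step sizes $(\gamma_k)_{k\ge 0}$ satisfying the error and step-size conditions (see context). Let $\bar s = \operatorname{argmin}_{s\in \operatorname{cl}(\operatorname{range}(\partial h))}\|s\|^2$. If $h^*$ is subdifferentiable at $\bar s$ (i.e. $\partial h^*(\bar s)\neq\emptyset$), or equivalently if there exists $\bar\lambda\in Y$ such that $\bar s\in\partial h(\bar\lambda)$, then $$\left|h^*(s_\star^k)-h^*(\bar s)\right| = O\left(\frac{1}{\sqrt{\sum_{i=0}^{k-1}\gamma_i}}\right)\quad (k\to\infty).$$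
   Context: Closed means lower semicontinuous. $h^*(s)=\sup_{\lambda\in Y}\langle s,\lambda\rangle - h(\lambda)$ is the convex conjugate, $\partial h$ the subdifferential, $\operatorname{range}(\partial h)=\bigcup_\lambda \partial h(\lambda)$, and $\operatorname{Prox}_{\gamma h}(\lambda)=\operatorname{argmin}_{\mu\in Y}\left(h(\mu)+\tfrac{1}{2\gamma}\|\lambda-\mu\|^2\right)$ for $\gamma>0$. The set $\operatorname{cl}(\operatorname{range}(\partial h))$ is a nonempty closed convex set, so $\bar s$ is its unique element of minimal norm. IPPA on $h$: given $\lambda^0\in Y$, $\gamma_k>0$ ($k\ge 0$) and $\varepsilon_k\ge 0$ ($k\ge 1$), for $k=0,1,2,\dots$: $\lambda_\star^{k+1}=\operatorname{Prox}_{\gamma_k h}(\lambda^k)$; $s_\star^{k+1}=(\lambda^k-\lambda_\star^{k+1})/\gamma_k$; $\lambda^{k+1}\in Y$ is any point with $\|\lambda^{k+1}-\lambda_\star^{k+1}\|\le\varepsilon_{k+1}$; $s^{k+1}=(\lambda^k-\lambda^{k+1})/\gamma_k$. Error and step-size conditions: $\gamma_k>0$, $\varepsilon_k\ge 0$, and (A1) $\sum_{k=1}^\infty\varepsilon_k<\infty$; (A2) $\frac{\varepsilon_{k+1}}{\gamma_k}\sum_{i=0}^k\gamma_i=O\left(\frac{1}{\sqrt{\sum_{i=0}^k\gamma_i}}\right)$; (A3) $\sum_{k=1}^\infty\left((\varepsilon_k/\gamma_k)^2\sum_{i=0}^{k-1}\gamma_i\right)<\infty$; (A4) $\sum_{k=1}^\infty\left((\varepsilon_k/\gamma_k)\sum_{i=1}^{k}\gamma_{i-1}\right)<\infty$;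 (A5) $\sum_{k=0}^\infty\gamma_k=\infty$. *)

theory Defs
  imports "HOL-Analysis.Analysis" "HOL-Library.Landau_Symbols"
begin

text \<open>
  Functions with values in the reals together with plus infinity are modelled as
  \<^typ>\<open>ereal\<close>-valued functions; the value minus infinity is excluded by properness.
\<close>

definition proper :: "('a \<Rightarrow> ereal) \<Rightarrow> bool" where
  "proper h \<longleftrightarrow> (\<forall>x. h x \<noteq> -\<infinity>) \<and> (\<exists>x. h x \<noteq> \<infinity>)"

text \<open>
  In \<^typ>\<open>ereal\<close> the sum of the two infinities is plus infinity and zero times infinity
  is zero; the first case does not arise below for proper functions, and the second gives
  the intended (trivial) inequality at the end points of the unit interval.
\<close>

definition convex_fun :: "('a::real_vector \<Rightarrow> ereal) \<Rightarrow> bool" where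
  "convex_fun h \<longleftrightarrow>
     (\<forall>x y. \<forall>t\<in>{0..1::real}.
        h ((1 - t) *\<^sub>R x + t *\<^sub>R y) \<le> ereal (1 - t) * h x + ereal t * h y)"

text \<open>Closedness means lower semicontinuity (with respect to the norm topology).\<close>

definition closed_fun :: "('a::topological_space \<Rightarrow> ereal) \<Rightarrow> bool" where
  "closed_fun h \<longleftrightarrow> (\<forall>x. h x \<le> Liminf (at x) h)"

definition conjugate :: "('a::real_inner \<Rightarrow> ereal) \<Rightarrow> 'a \<Rightarrow> ereal" where
  "conjugate h s = (SUP x. ereal (s \<bullet> x) - h x)"

text \<open>
  By the usual convention the subdifferential is empty at points where the function is not
  finite. For a proper function this already follows from the subgradient inequality.
\<close>

definition subdifferential :: "('a::real_inner \<Rightarrow> ereal) \<Rightarrow> 'a \<Rightarrow> 'a set" where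
  "subdifferential h x =
     {s. \<bar>h x\<bar> \<noteq> \<infinity> \<and> (\<forall>y. h x + ereal (s \<bullet> (y - x)) \<le> h y)}"

definition range_subdifferential :: "('a::real_inner \<Rightarrow> ereal) \<Rightarrow> 'a set" where
  "range_subdifferential h = (\<Union>x. subdifferential h x)"

text \<open>
  The operators \<^const>\<open>arg_min\<close> and \<^const>\<open>arg_min_on\<close> choose some minimiser, if there
  is one. In the two uses below, for a closed proper convex function on a Hilbert space,
  the minimiser exists and is unique.
\<close>

definition prox :: "real \<Rightarrow> ('a::real_inner \<Rightarrow> ereal) \<Rightarrow> 'a \<Rightarrow> 'a" where
  "prox \<gamma> h x = (ARG_MIN (\<lambda>y. h y + ereal (1 / (2 * \<gamma>) * (norm (x - y))\<^sup>2)) y. True)"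

definition min_norm_subgradient :: "('a::real_inner \<Rightarrow> ereal) \<Rightarrow> 'a" where
  "min_norm_subgradient h =
     arg_min_on (\<lambda>s. (norm s)\<^sup>2) (closure (range_subdifferential h))"

text \<open>
  The values of \<open>lstar\<close>, \<open>sstar\<close>, \<open>s\<close> and \<open>\<epsilon>\<close> at index 0 are irrelevant and unconstrained.
\<close>

definition ippa ::
  "('a::real_inner \<Rightarrow> ereal) \<Rightarrow> (nat \<Rightarrow> real) \<Rightarrow> (nat \<Rightarrow> real) \<Rightarrow>
   (nat \<Rightarrow> 'a) \<Rightarrow> (nat \<Rightarrow> 'a) \<Rightarrow> (nat \<Rightarrow> 'a) \<Rightarrow> (nat \<Rightarrow> 'a) \<Rightarrow> bool" where
  "ippa h \<gamma> \<epsilon> lstar sstar l s \<longleftrightarrow>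
     (\<forall>k. lstar (Suc k) = prox (\<gamma> k) h (l k)
        \<and> sstar (Suc k) = (1 / \<gamma> k) *\<^sub>R (l k - lstar (Suc k))
        \<and> norm (l (Suc k) - lstar (Suc k)) \<le> \<epsilon> (Suc k)
        \<and> s (Suc k) = (1 / \<gamma> k) *\<^sub>R (l k - l (Suc k)))"

text \<open>
  Series starting at index 1 are shifted to start at index 0, as \<^const>\<open>summable\<close> expects.
\<close>

definition error_step_conditions :: "(nat \<Rightarrow> real) \<Rightarrow> (nat \<Rightarrow> real) \<Rightarrow> bool" where
  "error_step_conditions \<gamma> \<epsilon> \<longleftrightarrow>
     (\<forall>k. \<gamma> k > 0) \<and> (\<forall>k\<ge>1. \<epsilon> k \<ge> 0)
   \<and> summable (\<lambda>k. \<epsilon> (Suc k))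
   \<and> (\<lambda>k. \<epsilon> (Suc k) / \<gamma> k * (\<Sum>i=0..k. \<gamma> i)) \<in> O(\<lambda>k. 1 / sqrt (\<Sum>i=0..k. \<gamma> i))
   \<and> summable (\<lambda>k. (\<epsilon> (Suc k) / \<gamma> (Suc k))\<^sup>2 * (\<Sum>i=0..k. \<gamma> i))
   \<and> summable (\<lambda>k. \<epsilon> (Suc k) / \<gamma> (Suc k) * (\<Sum>i=1..Suc k. \<gamma> (i - 1)))
   \<and> filterlim (\<lambda>k. \<Sum>i=0..k. \<gamma> i) at_top sequentially"

end

theory Submission
  imports Defs
begin

text \<open>
  The iterates \<open>lstar k\<close> stay at bounded distance from the ray \<open>lbar - \<sigma> k *\<^sub>R sbar\<close>, where \<open>\<sigma> k\<close>
  is the sum of the first \<open>k\<close> step sizes: since \<open>sbar\<close> has minimal norm in the closure of the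
  range of the subdifferential, \<open>sbar\<close> is a subgradient along the whole ray, so the exact
  algorithm started at \<open>lbar\<close> follows this ray, and proximal maps are nonexpansive. Subgradient
  inequalities then bound the gap of the conjugate by a constant times \<open>norm (sstar k - sbar)\<close>.
  The square of this norm is at most \<open>V k = (norm (sstar k))\<^sup>2 - (norm sbar)\<^sup>2\<close>, which is
  almost decreasing, and \<open>\<gamma> k * V (Suc k)\<close> is summable because it is controlled by the
  decrease of \<open>\<lambda>x. h x - sbar \<bullet> x\<close>, a function bounded below. Hence \<open>\<sigma> k * V k\<close> is bounded.
\<close>

section \<open>Extended-valued convex functions\<close>

lemma proper_cases [consumes 1, case_names fin inf]:
  assumes "proper h"
  obtains a where "h x = ereal a" | "h x = \<infinity>"
  using assms by (cases "h x") (auto simp: proper_def)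

lemma properE:
  assumes "proper h"
  obtains x a where "h x = ereal a"
  using assms by (metis ereal_cases proper_def)

lemma convex_funD:
  assumes "convex_fun h" "h x = ereal a" "h y = ereal b" "0 \<le> t" "t \<le> 1"
  shows "h (x + t *\<^sub>R (y - x)) \<le> ereal (a + t * (b - a))"
proof -
  have "h ((1 - t) *\<^sub>R x + t *\<^sub>R y) \<le> ereal (1 - t) * h x + ereal t * h y"
    using assms(1,4,5) by (auto simp: convex_fun_def)
  moreover have "(1 - t) *\<^sub>R x + t *\<^sub>R y = x + t *\<^sub>R (y - x)"
    by (simp add: algebra_simps)
  moreover have "ereal (1 - t) * h x + ereal t * h y = ereal (a + t * (b - a))"
    using assms by (simp add: algebra_simps)
  ultimately show ?thesis by simp
qed

lemma closed_fun_eventually_gt: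
  assumes "closed_fun h" "c < h x"
  shows "eventually (\<lambda>y. c < h y) (nhds x)"
proof -
  have "h x \<le> Liminf (at x) h" using assms(1) by (simp add: closed_fun_def)
  then have "eventually (\<lambda>y. c < h y) (at x)" using assms(2) by (auto simp: le_Liminf_iff)
  then show ?thesis using assms(2) by (auto simp: eventually_at_filter elim: eventually_mono)
qed

text \<open>Convexity propagates the local lower bound given by lower semicontinuity along rays.\<close>

lemma closed_convex_minorant:
  fixes h :: "'a::real_inner \<Rightarrow> ereal"
  assumes "closed_fun h" "proper h" "convex_fun h" and x0: "h x0 = ereal a"
  obtains K where "0 \<le> K" "\<And>y. ereal (a - 1 - K * norm (y - x0)) \<le> h y"
proof -
  have "eventually (\<lambda>y. ereal (a - 1) < h y) (nhds x0)"
    by (rule closed_fun_eventually_gt) (use assms in auto)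
  then obtain d where d: "d > 0" "\<And>y. dist y x0 < d \<Longrightarrow> ereal (a - 1) < h y"
    unfolding eventually_nhds_metric by blast
  \<comment> \<open>Half of \<open>d\<close>, so that points at distance exactly \<open>r\<close>
    still lie in the open ball.\<close>
  define r where "r = d / 2"
  have r: "r > 0" using d by (simp add: r_def)
  have "ereal (a - 1 - (1 / r) * norm (y - x0)) \<le> h y" for y
    using assms(2)
  proof (cases rule: proper_cases[where x = y])
    case inf
    then show ?thesis by simp
  next
    case (fin b)
    show ?thesis
    proof (cases "norm (y - x0) \<le> r")
      case True
      then have "ereal (a - 1) < h y" using d r by (auto simp: dist_norm r_def)
      moreover have "a - 1 - (1 / r) * norm (y - x0) \<le> a - 1" using r by simp
      ultimately show ?thesis using fin by auto
    next
      case False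
      \<comment> \<open>Places \<open>x0 + t *\<^sub>R (y - x0)\<close> on the sphere of radius
        \<open>r\<close>, where the local bound holds; convexity then carries it out to
        \<open>y\<close>.\<close>
      define t where "t = r / norm (y - x0)"
      have t: "0 < t" "t \<le> 1" using False r by (auto simp: t_def divide_simps)
      have "norm (t *\<^sub>R (y - x0)) = r" using False r by (auto simp: t_def)
      then have "ereal (a - 1) < h (x0 + t *\<^sub>R (y - x0))"
        using d r by (auto simp: dist_norm r_def)
      also have "\<dots> \<le> ereal (a + t * (b - a))"
        using convex_funD[OF assms(3) x0 fin] t by simp
      finally have "- 1 < t * (b - a)" by simp
      then have "- 1 / t < b - a" using t by (simp add: field_simps)
      moreover have "1 / t = (1 / r) * norm (y - x0)" by (simp add: t_def)
      ultimately show ?thesis using fin by simp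
    qed
  qed
  then show ?thesis using that[of "1 / r"] r by auto
qed

text \<open>The parallelogram law, read as strong convexity of the squared norm; it makes minimising
  sequences Cauchy.\<close>

lemma norm_midpoint:
  fixes u v :: "'a::real_inner"
  shows "(norm (u + (1/2) *\<^sub>R (v - u)))\<^sup>2 = ((norm u)\<^sup>2 + (norm v)\<^sup>2) / 2 - (norm (v - u))\<^sup>2 / 4"
  unfolding power2_norm_eq_inner
  by (simp add: inner_add_left inner_add_right inner_diff_left inner_diff_right inner_commute field_simps)

text \<open>The direct method: the minorant bounds the objective below, strong convexity makes a
  minimising sequence converge, and lower semicontinuity passes to the limit.\<close>

lemma prox_exists:
  fixes h :: "'a::{real_inner, complete_space} \<Rightarrow> ereal"
  assumes h: "closed_fun h" "proper h" "convex_fun h" and \<gamma>: "\<gamma> > 0"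
  obtains p where "\<And>y. h p + ereal (1 / (2 * \<gamma>) * (norm (x - p))\<^sup>2)
                        \<le> h y + ereal (1 / (2 * \<gamma>) * (norm (x - y))\<^sup>2)"
proof -
  define c where "c = 1 / (2 * \<gamma>)"
  have c: "c > 0" using \<gamma> by (simp add: c_def)
  define q where "q y = c * (norm (x - y))\<^sup>2" for y
  \<comment> \<open>Only finite values are collected, so the infimum is taken in the reals.\<close>
  define S where "S = {b + q y | y b. h y = ereal b}"
  obtain x0 a where x0: "h x0 = ereal a" by (rule properE[OF h(2)])
  have ne: "S \<noteq> {}" using x0 by (auto simp: S_def)
  obtain K where K: "0 \<le> K" "\<And>y. ereal (a - 1 - K * norm (y - x0)) \<le> h y"
    by (rule closed_convex_minorant[OF h x0]) (rule that)
  have bdd: "bdd_below S"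
  proof (rule bdd_belowI)
    fix z assume "z \<in> S"
    then obtain y b where yb: "z = b + q y" "h y = ereal b" by (auto simp: S_def)
    have 1: "a - 1 - K * norm (y - x0) \<le> b" using K(2)[of y] yb by simp
    have "norm (y - x0) \<le> norm (x - y) + norm (x - x0)"
      by (metis dist_norm dist_commute dist_triangle)
    then have 2: "K * norm (y - x0) \<le> K * norm (x - y) + K * norm (x - x0)"
      using K(1) by (metis distrib_left mult_left_mono)
    \<comment> \<open>Completing the square: the quadratic term absorbs the linear decrease of the
      minorant.\<close>
    have "0 \<le> c * (norm (x - y) - K / (2 * c))\<^sup>2" using c by simp
    also have "\<dots> = q y - K * norm (x - y) + K\<^sup>2 / (4 * c)"
      using c by (simp add: q_def power2_eq_square field_simps)
    finally show "a - 1 - K * norm (x - x0) - K\<^sup>2 / (4 * c) \<le> z"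
      using 1 2 yb by simp
  qed
  define m where "m = Inf S"
  have m: "m \<le> b + q y" if "h y = ereal b" for y b
    unfolding m_def by (rule cInf_lower[OF _ bdd]) (use that in \<open>auto simp: S_def\<close>)
  have "\<exists>y b. h y = ereal b \<and> b + q y < m + 1 / real (Suc n)" for n
  proof -
    have "Inf S < m + 1 / real (Suc n)" by (simp add: m_def)
    then show ?thesis using cInf_lessD[OF ne] by (fastforce simp: S_def)
  qed
  then obtain y b where yb: "\<And>n. h (y n) = ereal (b n)" "\<And>n. b n + q (y n) < m + 1 / real (Suc n)"
    by metis
  \<comment> \<open>The objective is at least \<open>m\<close> at the midpoint, while strong
    convexity puts it below the average of two nearly minimal values by the left-hand side.\<close>
  have gap: "c / 4 * (norm (y k - y n))\<^sup>2 \<le> (1 / real (Suc n) + 1 / real (Suc k)) / 2" for n k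
  proof -
    define z where "z = y n + (1/2) *\<^sub>R (y k - y n)"
    have "h z \<le> ereal (b n + 1/2 * (b k - b n))"
      unfolding z_def by (rule convex_funD[OF h(3) yb(1) yb(1)]) auto
    then obtain w where w: "h z = ereal w" "w \<le> b n + 1/2 * (b k - b n)"
      using h(2) by (cases "h z") (auto simp: proper_def)
    have "x - z = (x - y n) + (1/2) *\<^sub>R ((x - y k) - (x - y n))"
      by (simp add: z_def algebra_simps)
    then have z_eq: "(norm (x - z))\<^sup>2 = ((norm (x - y n))\<^sup>2 + (norm (x - y k))\<^sup>2) / 2 - (norm (y k - y n))\<^sup>2 / 4"
      by (simp only: norm_midpoint) (simp add: norm_minus_commute)
    have "q z = (q (y n) + q (y k)) / 2 - c / 4 * (norm (y k - y n))\<^sup>2"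
      unfolding q_def z_eq by (simp add: field_simps)
    then show ?thesis using m[OF w(1)] w(2) yb(2)[of n] yb(2)[of k] by argo
  qed
  have "Cauchy y"
  proof (rule CauchyI)
    fix e :: real assume e: "0 < e"
    then have "0 < c / 4 * e\<^sup>2" using c by simp
    then obtain N where N: "1 / real (Suc N) < c / 4 * e\<^sup>2"
      using nat_approx_posE by blast
    show "\<exists>M. \<forall>k\<ge>M. \<forall>n\<ge>M. norm (y k - y n) < e"
    proof (intro exI allI impI)
      fix k n assume "k \<ge> N" "n \<ge> N"
      then have le: "1 / real (Suc n) \<le> 1 / real (Suc N)" "1 / real (Suc k) \<le> 1 / real (Suc N)"
        by (auto simp: field_simps)
      have "c / 4 * (norm (y k - y n))\<^sup>2 \<le> (1 / real (Suc n) + 1 / real (Suc k)) / 2" by (rule gap)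
      also have "\<dots> \<le> (1 / real (Suc N) + 1 / real (Suc N)) / 2"
        by (intro divide_right_mono add_mono le) auto
      also have "\<dots> = 1 / real (Suc N)" by (simp only: add_divide_distrib field_sum_of_halves)
      also note N
      finally have "c / 4 * (norm (y k - y n))\<^sup>2 < c / 4 * e\<^sup>2" .
      then have "(norm (y k - y n))\<^sup>2 < e\<^sup>2" using c by simp
      then show "norm (y k - y n) < e" using e by (simp add: power_less_imp_less_base)
    qed
  qed
  then obtain p where p: "y \<longlonglongrightarrow> p" using Cauchy_convergent_iff convergent_def by blast
  have qp: "(\<lambda>n. q (y n)) \<longlonglongrightarrow> q p" unfolding q_def by (intro tendsto_intros p)
  have hp: "h p \<le> ereal (m - q p)"
  proof (rule ccontr)
    assume "\<not> ?thesis"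
    then obtain w where w: "m - q p < w" "ereal w < h p"
      using ereal_dense2[of "ereal (m - q p)" "h p"] by (auto simp: not_le)
    have "eventually (\<lambda>n. ereal w < h (y n)) sequentially"
      using closed_fun_eventually_gt[OF h(1) w(2)] p by (auto simp: filterlim_iff)
    then have ev: "eventually (\<lambda>n. w + q (y n) \<le> m + 1 / real (Suc n)) sequentially"
    proof eventually_elim
      case (elim n)
      then show ?case using yb[of n] by simp
    qed
    have "(\<lambda>n. m + 1 / real (Suc n)) \<longlonglongrightarrow> m + 0"
      by (intro tendsto_intros LIMSEQ_Suc[OF lim_1_over_n])
    moreover have "(\<lambda>n. w + q (y n)) \<longlonglongrightarrow> w + q p" by (intro tendsto_intros qp)
    ultimately have "w + q p \<le> m + 0" using tendsto_le[OF sequentially_bot _ _ ev] by blast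
    then show False using w by simp
  qed
  have "h p + ereal (q p) \<le> h z + ereal (q z)" for z
    using h(2)
  proof (cases rule: proper_cases[where x = z])
    case inf
    then show ?thesis by simp
  next
    case (fin v)
    have "h p + ereal (q p) \<le> ereal (m - q p) + ereal (q p)" by (rule add_right_mono[OF hp])
    then show ?thesis using m[OF fin] fin by (simp add: order_trans)
  qed
  then show ?thesis using that[of p] by (auto simp: q_def c_def)
qed

section \<open>Subgradients and conjugates\<close>

lemma subdifferential_iff:
  assumes "proper h"
  shows "s \<in> subdifferential h x \<longleftrightarrow>
    (\<exists>a. h x = ereal a \<and> (\<forall>y b. h y = ereal b \<longrightarrow> a + s \<bullet> (y - x) \<le> b))"
proof -
  have "(\<forall>y. ereal a + ereal (s \<bullet> (y - x)) \<le> h y) \<longleftrightarrow>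
      (\<forall>y b. h y = ereal b \<longrightarrow> a + s \<bullet> (y - x) \<le> b)" for a
    by (metis assms ereal_less_eq(1,3) plus_ereal.simps(1) proper_cases)
  then show ?thesis by (cases "h x") (auto simp: subdifferential_def)
qed

lemma subgradient_monotone:
  assumes "proper h" "s \<in> subdifferential h x" "t \<in> subdifferential h y"
  shows "0 \<le> (s - t) \<bullet> (x - y)"
proof -
  obtain a where a: "h x = ereal a" "\<And>y b. h y = ereal b \<Longrightarrow> a + s \<bullet> (y - x) \<le> b"
    using assms by (auto simp: subdifferential_iff)
  obtain b where b: "h y = ereal b" "\<And>x a. h x = ereal a \<Longrightarrow> b + t \<bullet> (x - y) \<le> a"
    using assms by (auto simp: subdifferential_iff)
  show ?thesis using a(2)[OF b(1)] b(2)[OF a(1)]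
    by (simp add: inner_diff_left inner_diff_right)
qed

lemma conjugate_le_iff:
  assumes "proper h"
  shows "conjugate h s \<le> ereal c \<longleftrightarrow> (\<forall>x a. h x = ereal a \<longrightarrow> s \<bullet> x - a \<le> c)"
proof -
  have "ereal (s \<bullet> x) - h x \<le> ereal c \<longleftrightarrow> (\<forall>a. h x = ereal a \<longrightarrow> s \<bullet> x - a \<le> c)" for x
    by (cases rule: proper_cases[OF assms, of x]) auto
  then show ?thesis by (auto simp: conjugate_def SUP_le_iff)
qed

lemma fenchel_young:
  assumes "h x = ereal a"
  shows "ereal (s \<bullet> x - a) \<le> conjugate h s"
proof -
  have "ereal (s \<bullet> x) - h x \<le> conjugate h s" unfolding conjugate_def by (rule SUP_upper) simp
  then show ?thesis using assms by simp
qed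

lemma conjugate_not_MInf:
  assumes "proper h"
  shows "conjugate h s \<noteq> -\<infinity>"
  using assms by (metis ereal_infty_less_eq(2) ereal_less_eq(2) fenchel_young properE MInfty_neq_ereal(1))

lemma conjugate_subgradient:
  assumes "proper h" "s \<in> subdifferential h x" "h x = ereal a"
  shows "conjugate h s = ereal (s \<bullet> x - a)"
proof (rule antisym)
  show "conjugate h s \<le> ereal (s \<bullet> x - a)"
    using assms by (auto simp: conjugate_le_iff subdifferential_iff inner_diff_right algebra_simps)
qed (rule fenchel_young[of h, OF assms(3)])

lemma proper_conjugate:
  assumes "proper h" "s \<in> subdifferential h x"
  shows "proper (conjugate h)"
proof -
  obtain a where "h x = ereal a" using assms by (auto simp: subdifferential_iff)
  then have "conjugate h s \<noteq> \<infinity>" using conjugate_subgradient[OF assms] by simp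
  then show ?thesis using conjugate_not_MInf[OF assms(1)] by (auto simp: proper_def)
qed

lemma subdifferential_conjugateI:
  assumes "proper h" "s \<in> subdifferential h x"
  shows "x \<in> subdifferential (conjugate h) s"
proof -
  obtain a where a: "h x = ereal a" using assms by (auto simp: subdifferential_iff)
  have "s \<bullet> x - a + x \<bullet> (t - s) \<le> c" if "conjugate h t = ereal c" for t c
    using fenchel_young[of h, OF a, of t] that by (simp add: inner_diff_right inner_commute)
  then show ?thesis
    using conjugate_subgradient[OF assms a] subdifferential_iff[OF proper_conjugate[OF assms]]
    by auto
qed

text \<open>Fermat's rule for the regularised objective: compare \<open>p\<close> with points of the
  segment towards \<open>y\<close>, divide by the segment parameter and let it tend to 0.\<close>

lemma minimizer_subgradient:
  fixes h :: "'a::real_inner \<Rightarrow> ereal"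
  assumes h: "proper h" "convex_fun h" and \<gamma>: "\<gamma> > 0"
    and min: "\<And>y. h p + ereal (1 / (2 * \<gamma>) * (norm (x - p))\<^sup>2)
                     \<le> h y + ereal (1 / (2 * \<gamma>) * (norm (x - y))\<^sup>2)"
  shows "(1 / \<gamma>) *\<^sub>R (x - p) \<in> subdifferential h p"
proof -
  define c where "c = 1 / (2 * \<gamma>)"
  obtain x0 a0 where x0: "h x0 = ereal a0" by (rule properE[OF h(1)])
  obtain a where a: "h p = ereal a"
    using min[of x0] x0 h(1) by (cases rule: proper_cases[OF h(1), of p]) auto
  have "a + ((1 / \<gamma>) *\<^sub>R (x - p)) \<bullet> (y - p) \<le> b" if b: "h y = ereal b" for y b
  proof -
    define I N where "I = (x - p) \<bullet> (y - p)" and "N = (norm (y - p))\<^sup>2"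
    have ineq: "2 * c * I - t * (c * N) \<le> b - a" if t: "0 < t" "t < 1" for t
    proof -
      define z where "z = p + t *\<^sub>R (y - p)"
      have "h p + ereal (c * (norm (x - p))\<^sup>2) \<le> h z + ereal (c * (norm (x - z))\<^sup>2)"
        using min[of z] by (simp add: c_def)
      also have "\<dots> \<le> ereal (a + t * (b - a)) + ereal (c * (norm (x - z))\<^sup>2)"
        unfolding z_def by (intro add_right_mono convex_funD[OF h(2) a b]) (use t in auto)
      finally have 1: "c * (norm (x - p))\<^sup>2 \<le> t * (b - a) + c * (norm (x - z))\<^sup>2" using a by simp
      have z_eq: "(norm (x - z))\<^sup>2 = (norm (x - p))\<^sup>2 - 2 * t * I + t\<^sup>2 * N"
        unfolding power2_norm_eq_inner z_def I_def N_def
        by (simp add: inner_add_left inner_add_right inner_diff_left inner_diff_right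
            inner_commute power2_eq_square algebra_simps)
      have "t * (2 * c * I - t * (c * N)) \<le> t * (b - a)"
        using 1 unfolding z_eq by (simp add: power2_eq_square algebra_simps)
      then show ?thesis using t by simp
    qed
    have lim: "((\<lambda>t. 2 * c * I - t * (c * N)) \<longlongrightarrow> 2 * c * I - 0 * (c * N)) (at_right 0)"
      by (intro tendsto_intros)
    have "eventually (\<lambda>t. 2 * c * I - t * (c * N) \<le> b - a) (at_right 0)"
      unfolding eventually_at_right_field using ineq by (intro exI[of _ 1]) auto
    then have "2 * c * I \<le> b - a"
      using tendsto_upperbound[OF lim] by simp
    then show ?thesis by (simp add: c_def I_def)
  qed
  then show ?thesis using a h(1) by (auto simp: subdifferential_iff)
qed

text \<open>Surjectivity in Minty's sense: every \<open>x\<close> is \<open>p\<close> plus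
  \<open>\<gamma>\<close> times a subgradient at \<open>p\<close>.\<close>

lemma resolvent_exists:
  fixes h :: "'a::{real_inner, complete_space} \<Rightarrow> ereal"
  assumes "closed_fun h" "proper h" "convex_fun h" "\<gamma> > 0"
  obtains p where "(1 / \<gamma>) *\<^sub>R (x - p) \<in> subdifferential h p"
  using prox_exists[OF assms] minimizer_subgradient[OF assms(2-4)] by metis

lemma prox_subgradient:
  fixes h :: "'a::{real_inner, complete_space} \<Rightarrow> ereal"
  assumes h: "closed_fun h" "proper h" "convex_fun h" "\<gamma> > 0"
  shows "(1 / \<gamma>) *\<^sub>R (x - prox \<gamma> h x) \<in> subdifferential h (prox \<gamma> h x)"
proof -
  define F where "F = (\<lambda>y. h y + ereal (1 / (2 * \<gamma>) * (norm (x - y))\<^sup>2))"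
  obtain p where p: "\<And>y. F p \<le> F y"
    using prox_exists[OF h, of x] unfolding F_def by metis
  \<comment> \<open>\<open>prox\<close> is defined by choice, so a minimiser must be exhibited
    before the chosen point is known to be one.\<close>
  have "is_arg_min F (\<lambda>_. True) p" using p by (auto simp: is_arg_min_def not_less)
  then have "is_arg_min F (\<lambda>_. True) (arg_min F (\<lambda>_. True))"
    unfolding arg_min_def by (rule someI)
  then have "F (prox \<gamma> h x) \<le> F y" for y
    by (simp add: is_arg_min_def not_less prox_def F_def)
  then show ?thesis using minimizer_subgradient[OF h(2-4)] by (auto simp: F_def)
qed

text \<open>The converse of \<open>subdifferential_conjugateI\<close> needs no biconjugation: comparing with the
  subgradient that the resolvent of \<open>x + s\<close> yields forces the resolvent to be \<open>x\<close> itself.\<close>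

lemma subdifferential_conjugateD:
  fixes h :: "'a::{real_inner, complete_space} \<Rightarrow> ereal"
  assumes h: "closed_fun h" "proper h" "convex_fun h"
    and x: "x \<in> subdifferential (conjugate h) s"
  shows "s \<in> subdifferential h x"
proof -
  obtain p where "(1 / 1) *\<^sub>R (x + s - p) \<in> subdifferential h p"
    using resolvent_exists[OF h zero_less_one] .
  then have p: "x + s - p \<in> subdifferential h p" by simp
  obtain a where a: "h p = ereal a" using p h by (auto simp: subdifferential_iff)
  obtain c where c: "conjugate h s = ereal c"
    and sub: "\<And>t d. conjugate h t = ereal d \<Longrightarrow> c + x \<bullet> (t - s) \<le> d"
    using x subdifferential_iff[OF proper_conjugate[OF h(2) p]] by blast
  \<comment> \<open>Test the subgradient inequality of the conjugate at \<open>x + s - p\<close>,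
    where the conjugate is known exactly; adding Fenchel-Young at \<open>s\<close> leaves the
    squared distance of \<open>x\<close> and \<open>p\<close>.\<close>
  have "c + x \<bullet> (x + s - p - s) \<le> (x + s - p) \<bullet> p - a"
    by (rule sub[OF conjugate_subgradient[OF h(2) p a]])
  moreover have "s \<bullet> p - a \<le> c" using fenchel_young[of h, OF a, of s] c by simp
  ultimately have "(x - p) \<bullet> (x - p) \<le> 0"
    by (simp add: inner_add_left inner_add_right inner_diff_left inner_diff_right inner_commute)
  then have "x = p" by (metis eq_iff_diff_eq_0 inner_gt_zero_iff not_less)
  then show ?thesis using p by simp
qed

section \<open>The minimal norm subgradient\<close>

text \<open>The range of the subdifferential need not be convex itself; its closure inherits
  convexity from this domain. The conjugate is a supremum of affine functions, whence the
  claim.\<close>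

lemma convex_conjugate_domain:
  assumes "proper h"
  shows "convex {s. conjugate h s < \<infinity>}"
proof (rule convexI)
  fix s s' and u v :: real
  assume ss: "s \<in> {s. conjugate h s < \<infinity>}" "s' \<in> {s. conjugate h s < \<infinity>}"
    and uv: "0 \<le> u" "0 \<le> v" "u + v = 1"
  obtain c where c: "conjugate h s \<le> ereal c"
    using ss(1) by (cases "conjugate h s") (auto simp: conjugate_not_MInf[OF assms])
  obtain d where d: "conjugate h s' \<le> ereal d"
    using ss(2) by (cases "conjugate h s'") (auto simp: conjugate_not_MInf[OF assms])
  have "conjugate h (u *\<^sub>R s + v *\<^sub>R s') \<le> ereal (u * c + v * d)"
    unfolding conjugate_le_iff[OF assms]
  proof (intro allI impI)
    fix x a assume a: "h x = ereal a"
    have "s \<bullet> x - a \<le> c" "s' \<bullet> x - a \<le> d" using a c d by (auto simp: conjugate_le_iff[OF assms])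
    then have "u * (s \<bullet> x - a) + v * (s' \<bullet> x - a) \<le> u * c + v * d"
      using uv by (intro add_mono mult_left_mono) auto
    moreover have "u * (s \<bullet> x - a) + v * (s' \<bullet> x - a) = (u *\<^sub>R s + v *\<^sub>R s') \<bullet> x - (u + v) * a"
      by (simp add: inner_add_left algebra_simps)
    ultimately show "(u *\<^sub>R s + v *\<^sub>R s') \<bullet> x - a \<le> u * c + v * d" using uv by simp
  qed
  then show "u *\<^sub>R s + v *\<^sub>R s' \<in> {s. conjugate h s < \<infinity>}" by (auto intro: le_less_trans)
qed

lemma range_subdifferential_subset_conjugate_domain:
  assumes "proper h"
  shows "range_subdifferential h \<subseteq> {s. conjugate h s < \<infinity>}"
  using assms conjugate_subgradient
  by (fastforce simp: range_subdifferential_def subdifferential_iff)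

text \<open>Resolvents of \<open>s\<close> with step size tending to infinity yield subgradients tending to \<open>s\<close>.\<close>

lemma conjugate_domain_subset_closure_range:
  fixes h :: "'a::{real_inner, complete_space} \<Rightarrow> ereal"
  assumes h: "closed_fun h" "proper h" "convex_fun h"
  shows "{s. conjugate h s < \<infinity>} \<subseteq> closure (range_subdifferential h)"
proof
  fix s assume "s \<in> {s. conjugate h s < \<infinity>}"
  then obtain c where c: "conjugate h s \<le> ereal c"
    by (cases "conjugate h s") (auto simp: conjugate_not_MInf[OF h(2)])
  obtain x0 a0 where x0: "h x0 = ereal a0" by (rule properE[OF h(2)])
  have cx: "s \<bullet> x - a \<le> c" if "h x = ereal a" for x a
    using c that by (auto simp: conjugate_le_iff[OF h(2)])
  define M where "M = a0 - s \<bullet> x0 + c"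
  have M: "M \<ge> 0" using cx[OF x0] by (simp add: M_def)
  show "s \<in> closure (range_subdifferential h)"
    unfolding closure_approachable
  proof (intro allI impI)
    fix e :: real assume e: "0 < e"
    \<comment> \<open>The resolvent displacement is \<open>g *\<^sub>R (t - s)\<close>, so the bound
      by \<open>M\<close> below says that \<open>g * (norm (t - s))\<^sup>2\<close> is at most
      \<open>M\<close>, which is less than \<open>g * e\<^sup>2 = M + 1\<close>.\<close>
    define g where "g = (M + 1) / e\<^sup>2"
    have g: "g > 0" using e M by (simp add: g_def)
    obtain p where p: "(1 / g) *\<^sub>R (x0 + g *\<^sub>R s - p) \<in> subdifferential h p"
      using resolvent_exists[OF h g] .
    define t where "t = (1 / g) *\<^sub>R (x0 + g *\<^sub>R s - p)"
    have gts: "x0 - p = g *\<^sub>R (t - s)" using g by (simp add: t_def algebra_simps)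
    obtain a where a: "h p = ereal a" "\<And>y b. h y = ereal b \<Longrightarrow> a + t \<bullet> (y - p) \<le> b"
      using p h(2) by (auto simp: subdifferential_iff t_def)
    have "(t - s) \<bullet> (x0 - p) \<le> M"
      using a(2)[OF x0] cx[OF a(1)] by (simp add: M_def inner_diff_left inner_diff_right)
    then have "g * (norm (t - s))\<^sup>2 < g * e\<^sup>2"
      using e by (simp add: gts power2_norm_eq_inner g_def)
    then have "(norm (t - s))\<^sup>2 < e\<^sup>2" using g by simp
    then have "dist t s < e" using e by (simp add: dist_norm power_less_imp_less_base)
    moreover have "t \<in> range_subdifferential h"
      using p by (auto simp: range_subdifferential_def t_def)
    ultimately show "\<exists>y\<in>range_subdifferential h. dist y s < e" by blast
  qed
qed

lemma convex_closure_range_subdifferential: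
  fixes h :: "'a::{real_inner, complete_space} \<Rightarrow> ereal"
  assumes "closed_fun h" "proper h" "convex_fun h"
  shows "convex (closure (range_subdifferential h))"
proof -
  have "closure (range_subdifferential h) = closure {s. conjugate h s < \<infinity>}"
    using conjugate_domain_subset_closure_range[OF assms]
      range_subdifferential_subset_conjugate_domain[OF assms(2)]
    by (metis closure_closure closure_mono subset_antisym)
  then show ?thesis using convex_closure[OF convex_conjugate_domain[OF assms(2)]] by simp
qed

text \<open>The projection of the origin is the proximal point of the indicator function of \<open>C\<close>.\<close>

lemma convex_min_norm_exists:
  fixes C :: "'a::{real_inner, complete_space} set"
  assumes C: "closed C" "convex C" "C \<noteq> {}"
  obtains p where "p \<in> C" "\<And>y. y \<in> C \<Longrightarrow> 0 \<le> p \<bullet> (y - p)"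
proof -
  define i :: "'a \<Rightarrow> ereal" where "i x = (if x \<in> C then 0 else \<infinity>)" for x
  have i: "closed_fun i" unfolding closed_fun_def le_Liminf_iff
  proof (intro allI impI)
    fix x y assume y: "y < i x"
    show "eventually (\<lambda>z. y < i z) (at x)"
    proof (cases "x \<in> C")
      case True
      then have "y < 0" using y by (simp add: i_def)
      then show ?thesis by (intro always_eventually) (auto simp: i_def intro: less_trans)
    next
      case False
      then have "eventually (\<lambda>z. z \<in> - C) (at x)"
        using C(1) by (intro eventually_at_topological[THEN iffD2] exI[of _ "- C"]) auto
      then show ?thesis using y by (auto simp: i_def elim!: eventually_mono)
    qed
  qed
  have "proper i" using C(3) by (auto simp: proper_def i_def)
  moreover have "convex_fun i" unfolding convex_fun_def
  proof (intro allI ballI)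
    fix x y and t :: real assume t: "t \<in> {0..1}"
    show "i ((1 - t) *\<^sub>R x + t *\<^sub>R y) \<le> ereal (1 - t) * i x + ereal t * i y"
    \<comment> \<open>At the end points zero times infinity is zero; otherwise a point outside
      \<open>C\<close> has positive weight and makes the right side infinite.\<close>
    proof (cases "t = 0 \<or> t = 1 \<or> x \<in> C \<and> y \<in> C")
      case True
      have "(1 - t) *\<^sub>R x + t *\<^sub>R y \<in> C" if "x \<in> C" "y \<in> C"
        using convexD[OF C(2) that, of "1 - t" t] t by simp
      then show ?thesis using True by (auto simp: i_def)
    next
      case False
      then have "0 < t" "t < 1" using t by auto
      then show ?thesis using False by (auto simp: i_def)
    qed
  qed
  ultimately obtain p where "(1 / 1) *\<^sub>R (0 - p) \<in> subdifferential i p"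
    using resolvent_exists[OF i _ _ zero_less_one] by blast
  then have ip: "\<bar>i p\<bar> \<noteq> \<infinity>" and sub: "\<And>y. i p + ereal ((- p) \<bullet> (y - p)) \<le> i y"
    by (auto simp: subdifferential_def)
  have p: "p \<in> C" using ip by (auto simp: i_def split: if_splits)
  have "0 \<le> p \<bullet> (y - p)" if "y \<in> C" for y
  proof -
    have "ereal (- (p \<bullet> (y - p))) \<le> ereal 0"
      using sub[of y] p that by (simp add: i_def zero_ereal_def)
    then show ?thesis by simp
  qed
  with p show ?thesis by (rule that)
qed

text \<open>The variational inequality for the projection of the origin. Since
  \<open>arg_min_on\<close> picks some minimiser, uniqueness must identify it with the
  projection.\<close>

lemma min_norm_subgradient_inner:
  fixes h :: "'a::{real_inner, complete_space} \<Rightarrow> ereal"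
  assumes h: "closed_fun h" "proper h" "convex_fun h"
    and s: "s \<in> closure (range_subdifferential h)"
  shows "0 \<le> min_norm_subgradient h \<bullet> (s - min_norm_subgradient h)"
proof -
  define C where "C = closure (range_subdifferential h)"
  have "closed C" "convex C" "C \<noteq> {}"
    using convex_closure_range_subdifferential[OF h] s by (auto simp: C_def)
  then obtain p where p: "p \<in> C" "\<And>y. y \<in> C \<Longrightarrow> 0 \<le> p \<bullet> (y - p)"
    by (rule convex_min_norm_exists) (rule that)
  have gap: "(norm p)\<^sup>2 + (norm (y - p))\<^sup>2 \<le> (norm y)\<^sup>2" if "y \<in> C" for y
    using p(2)[OF that] unfolding power2_norm_eq_inner
    by (simp add: inner_diff_left inner_diff_right inner_commute)
  have le: "(norm p)\<^sup>2 \<le> (norm y)\<^sup>2" if "y \<in> C" for y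
    using gap[OF that] zero_le_power2[of "norm (y - p)"] by linarith
  then have "is_arg_min (\<lambda>s. (norm s)\<^sup>2) (\<lambda>s. s \<in> C) p"
    using p(1) by (auto simp: is_arg_min_def not_less)
  then have "is_arg_min (\<lambda>s. (norm s)\<^sup>2) (\<lambda>s. s \<in> C) (min_norm_subgradient h)"
    unfolding min_norm_subgradient_def arg_min_on_def arg_min_def C_def by (rule someI)
  then have "min_norm_subgradient h \<in> C" "(norm (min_norm_subgradient h))\<^sup>2 \<le> (norm p)\<^sup>2"
    using p(1) unfolding is_arg_min_def by (auto simp: not_less)
  then have "(norm (min_norm_subgradient h - p))\<^sup>2 \<le> 0"
    using gap[of "min_norm_subgradient h"] by linarith
  then have "min_norm_subgradient h = p" by simp
  then show ?thesis using p(2) s by (simp add: C_def)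
qed

section \<open>The convergence rate\<close>

text \<open>Nonexpansiveness of resolvents in the form used: \<open>u\<close> is a difference of
  proximal points, \<open>v\<close> the scaled difference of their subgradients.\<close>

lemma norm_le_add_of_inner_nonneg:
  fixes u v :: "'a::real_inner"
  assumes "0 \<le> u \<bullet> v"
  shows "norm u \<le> norm (u + v)"
proof (rule power2_le_imp_le)
  show "(norm u)\<^sup>2 \<le> (norm (u + v))\<^sup>2"
    using assms unfolding power2_norm_eq_inner
    by (simp add: inner_add_left inner_add_right inner_commute)
qed simp

text \<open>Summation by parts: raising \<open>k\<close> adds \<open>\<gamma> k * V (Suc k)\<close>
  plus the old weight times the increase of \<open>V\<close>. The assumption omits index 0, where
  the weight is an empty sum.\<close>

lemma weighted_almost_decreasing_bound:
  fixes V \<gamma> \<eta> :: "nat \<Rightarrow> real"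
  assumes "\<And>k. 0 \<le> \<gamma> k" "\<And>k. 1 \<le> k \<Longrightarrow> V (Suc k) \<le> V k + \<eta> k"
  shows "(\<Sum>i<k. \<gamma> i) * V k \<le> (\<Sum>i<k. \<gamma> i * V (Suc i)) + (\<Sum>i<k. \<eta> i * (\<Sum>j<i. \<gamma> j))"
proof (induction k)
  case 0
  then show ?case by simp
next
  case (Suc k)
  have "(\<Sum>i<k. \<gamma> i) * V (Suc k) \<le> (\<Sum>i<k. \<gamma> i) * (V k + \<eta> k)"
  proof (cases "k = 0")
    case False
    then show ?thesis using assms by (intro mult_left_mono sum_nonneg) auto
  qed simp
  then show ?case using Suc by (simp add: algebra_simps)
qed

text \<open>The difference of the two sides is the squared norm of \<open>a - b + w\<close> plus
  twice the assumed inner product. An error \<open>w\<close> thus costs only its square.\<close>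

lemma power2_norm_le_of_inner_nonneg:
  fixes a b w :: "'a::real_inner"
  assumes "0 \<le> (a - b) \<bullet> (b - w)"
  shows "(norm b)\<^sup>2 \<le> (norm a)\<^sup>2 + (norm w)\<^sup>2"
proof -
  have "0 \<le> (norm (a - b + w))\<^sup>2" by simp
  then show ?thesis using assms unfolding power2_norm_eq_inner
    by (simp add: inner_add_left inner_add_right inner_diff_left inner_diff_right inner_commute)
qed

text \<open>By duality, \<open>x\<close> is a subgradient of the conjugate at the minimal norm
  point. The negative of that point is normal to the conjugate's domain there, so adding multiples
  of it preserves this.\<close>

lemma min_norm_subgradient_ray:
  fixes h :: "'a::{real_inner, complete_space} \<Rightarrow> ereal"
  assumes h: "closed_fun h" "proper h" "convex_fun h"
    and x: "min_norm_subgradient h \<in> subdifferential h x" and r: "0 \<le> r"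
  shows "min_norm_subgradient h \<in> subdifferential h (x - r *\<^sub>R min_norm_subgradient h)"
proof (rule subdifferential_conjugateD[OF h])
  let ?s = "min_norm_subgradient h"
  note sub_iff = subdifferential_iff[OF proper_conjugate[OF h(2) x]]
  obtain c where c: "conjugate h ?s = ereal c"
    and sub: "\<And>t d. conjugate h t = ereal d \<Longrightarrow> c + x \<bullet> (t - ?s) \<le> d"
    using subdifferential_conjugateI[OF h(2) x] sub_iff by blast
  have "c + (x - r *\<^sub>R ?s) \<bullet> (t - ?s) \<le> d" if d: "conjugate h t = ereal d" for t d
  proof -
    have "t \<in> closure (range_subdifferential h)"
      using conjugate_domain_subset_closure_range[OF h] d by auto
    then have "0 \<le> r * (?s \<bullet> (t - ?s))"
      using min_norm_subgradient_inner[OF h] r by simp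
    then show ?thesis using sub[OF d] by (simp add: inner_diff_left)
  qed
  then show "x - r *\<^sub>R ?s \<in> subdifferential (conjugate h) ?s"
    using c sub_iff by blast
qed

text \<open>The gap lies between \<open>y \<bullet> (s - t)\<close> and
  \<open>x \<bullet> (s - t)\<close>. The free shift along \<open>t\<close> matters when
  \<open>x\<close> itself is unbounded but stays near a ray of direction \<open>- t\<close>.\<close>

lemma conjugate_diff_le:
  fixes h :: "'a::real_inner \<Rightarrow> ereal"
  assumes h: "proper h" and s: "s \<in> subdifferential h x" and t: "t \<in> subdifferential h y"
    and t_inner: "0 \<le> t \<bullet> (s - t)" and r: "0 \<le> r"
  shows "\<bar>real_of_ereal (conjugate h s) - real_of_ereal (conjugate h t)\<bar>
    \<le> max (norm y) (norm (x + r *\<^sub>R t)) * norm (s - t)"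
proof -
  obtain a where a: "h x = ereal a" "\<And>z b. h z = ereal b \<Longrightarrow> a + s \<bullet> (z - x) \<le> b"
    using h s by (auto simp: subdifferential_iff)
  obtain b where b: "h y = ereal b" "\<And>z a. h z = ereal a \<Longrightarrow> b + t \<bullet> (z - y) \<le> a"
    using h t by (auto simp: subdifferential_iff)
  define D where "D = (s \<bullet> x - a) - (t \<bullet> y - b)"
  have D: "real_of_ereal (conjugate h s) - real_of_ereal (conjugate h t) = D"
    using conjugate_subgradient[OF h s a(1)] conjugate_subgradient[OF h t b(1)]
    by (simp add: D_def)
  have "D \<le> x \<bullet> (s - t)"
    using b(2)[OF a(1)] by (simp add: D_def inner_diff_left inner_diff_right inner_commute)
  also have "\<dots> \<le> (x + r *\<^sub>R t) \<bullet> (s - t)" using t_inner r by (simp add: inner_add_left)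
  also have "\<dots> \<le> norm (x + r *\<^sub>R t) * norm (s - t)" by (rule norm_cauchy_schwarz)
  also have "\<dots> \<le> max (norm y) (norm (x + r *\<^sub>R t)) * norm (s - t)"
    by (intro mult_right_mono) auto
  finally have upper: "D \<le> max (norm y) (norm (x + r *\<^sub>R t)) * norm (s - t)" .
  have "- D \<le> (- y) \<bullet> (s - t)"
    using a(2)[OF b(1)] by (simp add: D_def inner_diff_left inner_diff_right inner_commute)
  also have "\<dots> \<le> norm y * norm (s - t)" using norm_cauchy_schwarz[of "- y" "s - t"] by simp
  also have "\<dots> \<le> max (norm y) (norm (x + r *\<^sub>R t)) * norm (s - t)"
    by (intro mult_right_mono) auto
  finally show ?thesis using upper D by linarith
qed

theorem theorem2p6:
  fixes h :: "'a::{real_inner, complete_space} \<Rightarrow> ereal"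
    and \<gamma> \<epsilon> :: "nat \<Rightarrow> real"
    and lstar sstar l s :: "nat \<Rightarrow> 'a"
    and sbar :: 'a
  assumes "closed_fun h" and "proper h" and "convex_fun h"
    and "error_step_conditions \<gamma> \<epsilon>"
    and "ippa h \<gamma> \<epsilon> lstar sstar l s"
    and "sbar = min_norm_subgradient h"
  shows "(subdifferential (conjugate h) sbar \<noteq> {} \<longleftrightarrow> (\<exists>lbar. sbar \<in> subdifferential h lbar))
    \<and> (subdifferential (conjugate h) sbar \<noteq> {} \<longrightarrow>
         \<bar>conjugate h sbar\<bar> \<noteq> \<infinity>
       \<and> (\<forall>k\<ge>1. \<bar>conjugate h (sstar k)\<bar> \<noteq> \<infinity>)
       \<and> (\<lambda>k. \<bar>real_of_ereal (conjugate h (sstar k)) - real_of_ereal (conjugate h sbar)\<bar>)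
           \<in> O(\<lambda>k. 1 / sqrt (\<Sum>i<k. \<gamma> i)))"
proof -
  note h = assms(1-3)

  \<comment> \<open>Basic properties of the iteration\<close>
  define \<sigma> where "\<sigma> k = (\<Sum>i<k. \<gamma> i)" for k
  have \<sigma>_Suc: "(\<Sum>i=0..k. \<gamma> i) = \<sigma> (Suc k)" for k
    by (simp add: \<sigma>_def atLeast0AtMost lessThan_Suc_atMost)
  have \<gamma>: "\<gamma> k > 0" and \<epsilon>: "\<epsilon> (Suc k) \<ge> 0" for k
    using assms(4) by (auto simp: error_step_conditions_def)
  have sum\<epsilon>: "summable (\<lambda>k. \<epsilon> (Suc k))"
    and sum\<eta>\<sigma>: "summable (\<lambda>k. (\<epsilon> (Suc k) / \<gamma> (Suc k))\<^sup>2 * \<sigma> (Suc k))"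
    using assms(4) by (auto simp: error_step_conditions_def \<sigma>_Suc)
  have \<sigma>0: "\<sigma> k \<ge> 0" for k unfolding \<sigma>_def using \<gamma> by (intro sum_nonneg less_imp_le)
  have \<sigma>1: "\<sigma> (Suc k) \<ge> \<gamma> 0" for k
    unfolding \<sigma>_def using \<gamma> by (intro member_le_sum) (auto intro: less_imp_le)
  have step: "l k = lstar (Suc k) + \<gamma> k *\<^sub>R sstar (Suc k)"
    and err: "norm (l (Suc k) - lstar (Suc k)) \<le> \<epsilon> (Suc k)"
    and sub: "sstar (Suc k) \<in> subdifferential h (lstar (Suc k))" for k
  proof -
    have *: "lstar (Suc k) = prox (\<gamma> k) h (l k)"
      "sstar (Suc k) = (1 / \<gamma> k) *\<^sub>R (l k - lstar (Suc k))"
      "norm (l (Suc k) - lstar (Suc k)) \<le> \<epsilon> (Suc k)"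
      using assms(5) unfolding ippa_def by blast+
    show "norm (l (Suc k) - lstar (Suc k)) \<le> \<epsilon> (Suc k)" by (rule *(3))
    show "l k = lstar (Suc k) + \<gamma> k *\<^sub>R sstar (Suc k)" using * \<gamma>[of k] by simp
    show "sstar (Suc k) \<in> subdifferential h (lstar (Suc k))"
      using prox_subgradient[OF h \<gamma>[of k], of "l k"] * by simp
  qed
  have dir: "0 \<le> sbar \<bullet> (sstar (Suc k) - sbar)" for k
  proof -
    have "sstar (Suc k) \<in> closure (range_subdifferential h)"
      using sub closure_subset by (force simp: range_subdifferential_def)
    then show ?thesis using min_norm_subgradient_inner[OF h] assms(6) by simp
  qed
  have iff: "subdifferential (conjugate h) sbar \<noteq> {} \<longleftrightarrow> (\<exists>lbar. sbar \<in> subdifferential h lbar)"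
    using subdifferential_conjugateI[OF h(2)] subdifferential_conjugateD[OF h] by blast
  have fin: "\<bar>conjugate h t\<bar> \<noteq> \<infinity>" if "t \<in> subdifferential h x" for t x
    using that conjugate_subgradient[OF h(2) that] by (auto simp: subdifferential_iff[OF h(2)])
  have rate: "(\<lambda>k. \<bar>real_of_ereal (conjugate h (sstar k)) - real_of_ereal (conjugate h sbar)\<bar>)
           \<in> O(\<lambda>k. 1 / sqrt (\<Sum>i<k. \<gamma> i))"
    if lbar: "sbar \<in> subdifferential h lbar" for lbar
  proof -
    \<comment> \<open>The exact iteration started at \<open>lbar\<close>, which always sees the subgradient \<open>sbar\<close>.\<close>
    define \<mu> where "\<mu> k = lbar - \<sigma> k *\<^sub>R sbar" for k
    have \<mu>: "sbar \<in> subdifferential h (\<mu> k)" for k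
      unfolding \<mu>_def using min_norm_subgradient_ray[OF h] lbar \<sigma>0 assms(6) by simp
    \<comment> \<open>Both points result from an exact step of size \<open>\<gamma> k\<close>, from
      \<open>l k\<close> and from \<open>\<mu> k\<close>; monotonicity makes such steps
      nonexpansive.\<close>
    have contr: "norm (lstar (Suc k) - \<mu> (Suc k)) \<le> norm (l k - \<mu> k)" for k
    proof -
      have "0 \<le> (sstar (Suc k) - sbar) \<bullet> (lstar (Suc k) - \<mu> (Suc k))"
        by (rule subgradient_monotone[OF h(2) sub \<mu>])
      then have "0 \<le> (lstar (Suc k) - \<mu> (Suc k)) \<bullet> (\<gamma> k *\<^sub>R (sstar (Suc k) - sbar))"
        using \<gamma>[of k] by (simp add: inner_commute)
      moreover have "(lstar (Suc k) - \<mu> (Suc k)) + \<gamma> k *\<^sub>R (sstar (Suc k) - sbar) = l k - \<mu> k"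
        by (simp add: step[of k] \<mu>_def \<sigma>_def algebra_simps)
      ultimately show ?thesis using norm_le_add_of_inner_nonneg by metis
    qed
    define E where "E = (\<Sum>k. \<epsilon> (Suc k))"
    have E: "(\<Sum>i<k. \<epsilon> (Suc i)) \<le> E" for k
      unfolding E_def using sum\<epsilon> \<epsilon> by (intro sum_le_suminf) auto
    have "norm (l k - \<mu> k) \<le> norm (l 0 - lbar) + (\<Sum>i<k. \<epsilon> (Suc i))" for k
    proof (induction k)
      case 0
      then show ?case by (simp add: \<mu>_def \<sigma>_def)
    next
      case (Suc k)
      have "norm (l (Suc k) - \<mu> (Suc k))
          \<le> norm (l (Suc k) - lstar (Suc k)) + norm (lstar (Suc k) - \<mu> (Suc k))"
        using norm_triangle_ineq[of "l (Suc k) - lstar (Suc k)" "lstar (Suc k) - \<mu> (Suc k)"] by simp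
      then show ?case using err[of k] contr[of k] Suc by simp
    qed
    then have "norm (lstar (Suc k) - \<mu> (Suc k)) \<le> norm (l 0 - lbar) + E" for k
      using contr[of k] E[of k] by (meson add_left_mono order_trans)
    moreover have "norm (lstar k + \<sigma> k *\<^sub>R sbar) \<le> norm (lstar k - \<mu> k) + norm lbar" for k
      using norm_triangle_ineq[of "lstar k - \<mu> k" lbar] by (simp add: \<mu>_def)
    ultimately have bdd: "norm (lstar (Suc k) + \<sigma> (Suc k) *\<^sub>R sbar)
        \<le> norm (l 0 - lbar) + E + norm lbar" for k
      by (meson add_right_mono order_trans)

    \<comment> \<open>Unlike \<open>norm (sstar k - sbar)\<close>, this quantity is decreasing up to the errors.\<close>
    define V where "V k = (norm (sstar k))\<^sup>2 - (norm sbar)\<^sup>2" for k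
    define \<eta> where "\<eta> k = (\<epsilon> k / \<gamma> k)\<^sup>2" for k
    have V_ge: "(norm (sstar (Suc k) - sbar))\<^sup>2 \<le> V (Suc k)" for k
      using dir[of k] unfolding V_def power2_norm_eq_inner
      by (simp add: inner_diff_left inner_diff_right inner_commute)
    have moved: "lstar (Suc k) - lstar (Suc (Suc k))
        = \<gamma> (Suc k) *\<^sub>R sstar (Suc (Suc k)) - (l (Suc k) - lstar (Suc k))" for k
      by (simp add: step[of "Suc k"])
    have V_step: "V (Suc (Suc k)) \<le> V (Suc k) + \<eta> (Suc k)" for k
    proof -
      define g where "g = \<gamma> (Suc k)"
      \<comment> \<open>The error in units of the step size: the displacement of the proximal points
        becomes \<open>g *\<^sub>R (sstar (Suc (Suc k)) - w)\<close>.\<close>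
      define w where "w = (1 / g) *\<^sub>R (l (Suc k) - lstar (Suc k))"
      have g: "g > 0" using \<gamma> by (simp add: g_def)
      have "norm w \<le> \<epsilon> (Suc k) / g"
        using err[of k] g by (simp add: w_def divide_right_mono)
      then have w: "(norm w)\<^sup>2 \<le> \<eta> (Suc k)" unfolding \<eta>_def g_def by (intro power_mono) auto
      have "lstar (Suc k) - lstar (Suc (Suc k)) = g *\<^sub>R (sstar (Suc (Suc k)) - w)"
        unfolding moved using g by (simp add: w_def scaleR_diff_right flip: g_def)
      then have "0 \<le> g * ((sstar (Suc k) - sstar (Suc (Suc k))) \<bullet> (sstar (Suc (Suc k)) - w))"
        using subgradient_monotone[OF h(2) sub[of k] sub[of "Suc k"]] by simp
      then have "0 \<le> (sstar (Suc k) - sstar (Suc (Suc k))) \<bullet> (sstar (Suc (Suc k)) - w)"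
        using g by (simp add: zero_le_mult_iff)
      from power2_norm_le_of_inner_nonneg[OF this] show ?thesis using w by (simp add: V_def)
    qed
    \<comment> \<open>The weights \<open>\<sigma> (Suc k)\<close> are at least
      \<open>\<gamma> 0\<close>, so weighted summability gives the plain one.\<close>
    have sum\<eta>: "summable (\<lambda>k. \<eta> (Suc k))"
    proof (rule summable_comparison_test')
      show "summable (\<lambda>k. (1 / \<gamma> 0) * (\<eta> (Suc k) * \<sigma> (Suc k)))"
        using sum\<eta>\<sigma> by (intro summable_mult) (simp add: \<eta>_def)
      fix k
      have "\<eta> (Suc k) * \<gamma> 0 \<le> \<eta> (Suc k) * \<sigma> (Suc k)"
        using \<sigma>1 by (intro mult_left_mono) (auto simp: \<eta>_def)
      then have "\<eta> (Suc k) \<le> \<eta> (Suc k) * \<sigma> (Suc k) / \<gamma> 0"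
        using \<gamma>[of 0] by (simp add: pos_le_divide_eq)
      then show "norm (\<eta> (Suc k)) \<le> (1 / \<gamma> 0) * (\<eta> (Suc k) * \<sigma> (Suc k))"
        by (simp add: \<eta>_def)
    qed
    have "V (Suc k) \<le> V 1 + (\<Sum>i<k. \<eta> (Suc i))" for k
    proof (induction k)
      case (Suc k)
      then show ?case using V_step[of k] by simp
    qed simp
    moreover have "(\<Sum>i<k. \<eta> (Suc i)) \<le> (\<Sum>k. \<eta> (Suc k))" for k
      using sum\<eta> by (intro sum_le_suminf) (auto simp: \<eta>_def)
    ultimately have "V (Suc k) \<le> V 1 + (\<Sum>k. \<eta> (Suc k))" for k
      by (meson add_left_mono order_trans)
    then have "(norm (sstar (Suc k) - sbar))\<^sup>2 \<le> V 1 + (\<Sum>k. \<eta> (Suc k))" for k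
      using V_ge order_trans by blast
    then obtain M where M: "\<And>k. norm (sstar (Suc k) - sbar) \<le> M"
      using real_le_rsqrt by metis
    have "M \<ge> 0" using M[of 0] norm_ge_zero order_trans by blast

    \<comment> \<open>Descent of the tilted function\<close>
    have "\<exists>a. h (lstar (Suc k)) = ereal a" for k
      using sub[of k] by (auto simp: subdifferential_iff[OF h(2)])
    then obtain H where H: "\<And>k. h (lstar (Suc k)) = ereal (H k)" by metis
    obtain c where c: "conjugate h sbar = ereal c" using fin[OF lbar] by auto
    \<comment> \<open>The Fenchel-Young gap at slope \<open>sbar\<close>, hence nonnegative; index
      \<open>k\<close> belongs to \<open>lstar (Suc k)\<close>.\<close>
    define f where "f k = H k - sbar \<bullet> lstar (Suc k) + c" for k
    have f: "f k \<ge> 0" for k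
      using fenchel_young[of h, OF H, of sbar k] c by (simp add: f_def)
    have descent: "\<gamma> (Suc k) * V (Suc (Suc k)) \<le> 2 * (f k - f (Suc k) + M * \<epsilon> (Suc k))" for k
    proof -
      define t e where "t = sstar (Suc (Suc k))" and "e = l (Suc k) - lstar (Suc k)"
      have "H (Suc k) + t \<bullet> (lstar (Suc k) - lstar (Suc (Suc k))) \<le> H k"
        using sub[of "Suc k"] H[of k] H[of "Suc k"] by (auto simp: subdifferential_iff[OF h(2)] t_def)
      then have "(t - sbar) \<bullet> (lstar (Suc k) - lstar (Suc (Suc k))) \<le> f k - f (Suc k)"
        by (simp add: f_def inner_diff_left inner_diff_right)
      then have 1: "\<gamma> (Suc k) * ((t - sbar) \<bullet> t) - (t - sbar) \<bullet> e \<le> f k - f (Suc k)"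
        unfolding moved by (simp add: inner_diff_right t_def e_def)
      have "(t - sbar) \<bullet> e \<le> norm (t - sbar) * norm e" by (rule norm_cauchy_schwarz)
      also have "\<dots> \<le> M * \<epsilon> (Suc k)"
        using M[of "Suc k"] err[of k] \<open>M \<ge> 0\<close> by (intro mult_mono) (auto simp: t_def e_def)
      finally have 2: "(t - sbar) \<bullet> e \<le> M * \<epsilon> (Suc k)" .
      \<comment> \<open>Half of this square is exactly \<open>(t - sbar) \<bullet> t\<close> minus
        half of \<open>V\<close>.\<close>
      have "0 \<le> (norm (t - sbar))\<^sup>2" by simp
      then have "V (Suc (Suc k)) / 2 \<le> (t - sbar) \<bullet> t"
        unfolding V_def power2_norm_eq_inner t_def[symmetric]
        by (simp add: inner_diff_left inner_diff_right inner_commute)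
      then have "\<gamma> (Suc k) * (V (Suc (Suc k)) / 2) \<le> \<gamma> (Suc k) * ((t - sbar) \<bullet> t)"
        using \<gamma>[of "Suc k"] by (intro mult_left_mono) auto
      then show ?thesis using 1 2 by simp
    qed
    \<comment> \<open>The first step, which \<open>descent\<close> does not cover, then the
      telescoped decrease with its errors, then the weighted increases of \<open>V\<close>.\<close>
    define K where "K = \<gamma> 0 * V 1 + 2 * f 0 + 2 * M * E + (\<Sum>k. \<eta> (Suc k) * \<sigma> (Suc k))"
    have \<sigma>V: "\<sigma> (Suc k) * V (Suc k) \<le> K" for k
    proof -
      have "(\<Sum>i<k. \<gamma> (Suc i) * V (Suc (Suc i))) \<le> 2 * (f 0 - f k + M * (\<Sum>i<k. \<epsilon> (Suc i)))"
      proof (induction k)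
        case (Suc k)
        then show ?case using descent[of k] by (simp add: algebra_simps)
      qed simp
      also have "\<dots> \<le> 2 * f 0 + 2 * M * E"
        using f[of k] mult_left_mono[OF E[of k] \<open>M \<ge> 0\<close>] by simp
      finally have "(\<Sum>i<Suc k. \<gamma> i * V (Suc i)) \<le> \<gamma> 0 * V 1 + 2 * f 0 + 2 * M * E"
        by (simp add: sum.lessThan_Suc_shift del: sum.lessThan_Suc)
      \<comment> \<open>The unconstrained \<open>\<eta> 0\<close> drops out because
        \<open>\<sigma> 0\<close> is zero.\<close>
      moreover have "(\<Sum>i<Suc k. \<eta> i * \<sigma> i) = (\<Sum>i<k. \<eta> (Suc i) * \<sigma> (Suc i))"
        by (simp add: sum.lessThan_Suc_shift \<sigma>_def del: sum.lessThan_Suc)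
      moreover have "\<dots> \<le> (\<Sum>k. \<eta> (Suc k) * \<sigma> (Suc k))"
        using sum\<eta>\<sigma> \<sigma>0 by (intro sum_le_suminf) (auto simp: \<eta>_def)
      moreover have "\<sigma> (Suc k) * V (Suc k)
          \<le> (\<Sum>i<Suc k. \<gamma> i * V (Suc i)) + (\<Sum>i<Suc k. \<eta> i * \<sigma> i)"
        unfolding \<sigma>_def
      proof (rule weighted_almost_decreasing_bound)
        show "0 \<le> \<gamma> k" for k using \<gamma> less_imp_le by blast
        show "V (Suc k) \<le> V k + \<eta> k" if "1 \<le> k" for k
          using V_step[of "k - 1"] that by simp
      qed
      ultimately show ?thesis unfolding K_def by linarith
    qed

    \<comment> \<open>Dominates both entries of the maximum in \<open>conjugate_diff_le\<close>,
      taken with shift \<open>\<sigma> (Suc k)\<close> and reference point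
      \<open>lbar\<close>.\<close>
    define C where "C = norm (l 0 - lbar) + E + norm lbar"
    have "E \<ge> 0" using E[of 0] by simp
    have bound: "\<bar>real_of_ereal (conjugate h (sstar (Suc k))) - real_of_ereal (conjugate h sbar)\<bar>
        \<le> C * sqrt K * (1 / sqrt (\<sigma> (Suc k)))" for k
    proof -
      have pos: "\<sigma> (Suc k) > 0" using \<sigma>1[of k] \<gamma>[of 0] by linarith
      have "norm (sstar (Suc k) - sbar) \<le> sqrt (V (Suc k))"
        using V_ge by (rule real_le_rsqrt)
      also have "\<dots> \<le> sqrt (K / \<sigma> (Suc k))"
        using \<sigma>V[of k] pos by (simp add: field_simps)
      finally have d: "norm (sstar (Suc k) - sbar) \<le> sqrt K * (1 / sqrt (\<sigma> (Suc k)))"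
        by (simp add: real_sqrt_divide)
      have "\<bar>real_of_ereal (conjugate h (sstar (Suc k))) - real_of_ereal (conjugate h sbar)\<bar>
          \<le> max (norm lbar) (norm (lstar (Suc k) + \<sigma> (Suc k) *\<^sub>R sbar))
              * norm (sstar (Suc k) - sbar)"
        by (rule conjugate_diff_le[OF h(2) sub lbar dir \<sigma>0])
      also have "\<dots> \<le> C * (sqrt K * (1 / sqrt (\<sigma> (Suc k))))"
        using bdd[of k] d \<open>E \<ge> 0\<close> by (intro mult_mono) (auto simp: C_def)
      finally show ?thesis by (simp add: mult.assoc)
    qed
    show ?thesis
    proof (rule bigoI[where c = "C * sqrt K"])
      show "eventually (\<lambda>k. norm \<bar>real_of_ereal (conjugate h (sstar k)) - real_of_ereal (conjugate h sbar)\<bar>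
          \<le> C * sqrt K * norm (1 / sqrt (\<Sum>i<k. \<gamma> i))) sequentially"
        \<comment> \<open>Index 0 is excluded since \<open>sstar 0\<close> is arbitrary.\<close>
        using eventually_ge_at_top[of 1]
      proof eventually_elim
        case (elim k)
        then obtain j where "k = Suc j" by (cases k) auto
        then show ?case using bound[of j] \<sigma>0[of k] by (simp add: \<sigma>_def)
      qed
    qed
  qed
  have fin_sstar: "\<forall>k\<ge>1. \<bar>conjugate h (sstar k)\<bar> \<noteq> \<infinity>"
  proof (intro allI impI)
    fix k :: nat assume "1 \<le> k"
    then show "\<bar>conjugate h (sstar k)\<bar> \<noteq> \<infinity>" using fin[OF sub[of "k - 1"]] by simp
  qed
  show ?thesis
  proof (intro conjI impI)
    assume "subdifferential (conjugate h) sbar \<noteq> {}"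
    then obtain lbar where lbar: "sbar \<in> subdifferential h lbar" using iff by blast
    show "\<bar>conjugate h sbar\<bar> \<noteq> \<infinity>" by (rule fin[OF lbar])
    show "(\<lambda>k. \<bar>real_of_ereal (conjugate h (sstar k)) - real_of_ereal (conjugate h sbar)\<bar>)
        \<in> O(\<lambda>k. 1 / sqrt (\<Sum>i<k. \<gamma> i))"
      by (rule rate[OF lbar])
  qed (rule iff fin_sstar)+
qed

end
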